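(* The functional $u\mapsto\int_{\mathbb{D}} e^{4\pi u^2}\,dx$, considered on the set $\{u\in H_{0,r}^1(\mathbb{D}) : \|u\|_{2^*}<1\}$, is continuous with respect to the norm $\|\cdot\|_{2^*}$.
   Context: $\mathbb{D}$ is the open unit disk in $\mathbb{R}^2$. $H_0^1(\mathbb{D})$ is the usual Sobolev space with norm $\|\nabla u\|_2$, and $H_{0,r}^1(\mathbb{D})$ is its subspace of radial functions. A radial function is written $u(r)$ with $r=|x|$; elements of $H_{0,r}^1(\mathbb{D})$ are identified with their representatives that are continuous on $\mathbb{D}\setminus\{0\}$. For $u\in H_{0,r}^1(\mathbb{D})$ define $$\|u\|_{2^*}=\sup_{r\in(0,1)}\frac{|u(r)|}{\left(\frac{1}{2\pi}\log\frac{1}{r}\right)^{1/2}}.$$ *)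

theory Defs
  imports "HOL-Analysis.Analysis"
begin

primrec Ck :: "nat \<Rightarrow> ('a::euclidean_space \<Rightarrow> real) \<Rightarrow> bool" where
  "Ck 0 f \<longleftrightarrow> continuous_on UNIV f"
| "Ck (Suc k) f \<longleftrightarrow> (\<forall>x. f differentiable (at x)) \<and>
     (\<forall>v. Ck k (\<lambda>x. frechet_derivative f (at x) v))"

definition test_functions :: "'a::euclidean_space set \<Rightarrow> ('a \<Rightarrow> real) set" where
  "test_functions \<Omega> = {\<phi>. (\<forall>k. Ck k \<phi>) \<and>
     compact (closure {x. \<phi> x \<noteq> 0}) \<and> closure {x. \<phi> x \<noteq> 0} \<subseteq> \<Omega>}"

definition grad :: "('a::euclidean_space \<Rightarrow> real) \<Rightarrow> 'a \<Rightarrow> 'a" where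
  "grad \<phi> x = (\<Sum>b\<in>Basis. frechet_derivative \<phi> (at x) b *\<^sub>R b)"

definition L2 :: "'a::euclidean_space set \<Rightarrow> ('a \<Rightarrow> 'b::euclidean_space) set" where
  "L2 \<Omega> = {f. f \<in> borel_measurable (lebesgue_on \<Omega>) \<and>
     integrable (lebesgue_on \<Omega>) (\<lambda>x. (norm (f x))\<^sup>2)}"

definition L2_norm :: "'a::euclidean_space set \<Rightarrow> ('a \<Rightarrow> 'b::euclidean_space) \<Rightarrow> real" where
  "L2_norm \<Omega> f = sqrt (integral\<^sup>L (lebesgue_on \<Omega>) (\<lambda>x. (norm (f x))\<^sup>2))"

definition weak_gradient ::
    "'a::euclidean_space set \<Rightarrow> ('a \<Rightarrow> real) \<Rightarrow> ('a \<Rightarrow> 'a) \<Rightarrow> bool" where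
  "weak_gradient \<Omega> u g \<longleftrightarrow> (\<forall>\<phi>\<in>test_functions \<Omega>. \<forall>b\<in>Basis.
     integral\<^sup>L (lebesgue_on \<Omega>) (\<lambda>x. u x * (grad \<phi> x \<bullet> b)) =
     - integral\<^sup>L (lebesgue_on \<Omega>) (\<lambda>x. (g x \<bullet> b) * \<phi> x))"

text \<open>The closure of the test functions in the space of square integrable functions with
  square integrable weak gradient. On a bounded set the Poincare inequality makes the full norm
  used for this closure equivalent to the \<open>L2\<close> norm of the gradient. Elements are
  functions rather than classes modulo null sets.\<close>

definition H10 :: "'a::euclidean_space set \<Rightarrow> ('a \<Rightarrow> real) set" where
  "H10 \<Omega> = {u. u \<in> L2 \<Omega> \<and> (\<exists>g. g \<in> L2 \<Omega> \<and> weak_gradient \<Omega> u g \<and>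
     (\<exists>\<phi>. (\<forall>n. \<phi> n \<in> test_functions \<Omega>) \<and>
       (\<lambda>n::nat. L2_norm \<Omega> (\<lambda>x. \<phi> n x - u x)) \<longlonglongrightarrow> 0 \<and>
       (\<lambda>n. L2_norm \<Omega> (\<lambda>x. grad (\<phi> n) x - g x)) \<longlonglongrightarrow> 0))}"

abbreviation unit_disk :: "(real^2) set" where
  "unit_disk \<equiv> ball 0 1"

text \<open>Each class of radial functions is represented by its member that is continuous and
  rotation invariant at every point of the punctured disk; the values at the origin and outside
  the disk are left arbitrary, and nothing below depends on them.\<close>

definition H10_radial :: "((real^2) \<Rightarrow> real) set" where
  "H10_radial = {u \<in> H10 unit_disk.
     (\<forall>x\<in>unit_disk - {0}. \<forall>y\<in>unit_disk - {0}. norm x = norm y \<longrightarrow> u x = u y) \<and>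
     continuous_on (unit_disk - {0}) u}"

text \<open>The value \<open>u(r)\<close> of a radial function, read off on the positive first axis.\<close>

definition radial_profile :: "((real^2) \<Rightarrow> real) \<Rightarrow> real \<Rightarrow> real" where
  "radial_profile u r = u (axis 1 r)"

text \<open>The supremum is taken in the extended reals, so that an unbounded quotient gives
  \<open>\<infinity>\<close> rather than an unspecified real.\<close>

definition norm_2star :: "((real^2) \<Rightarrow> real) \<Rightarrow> ereal" where
  "norm_2star u =
     (SUP r\<in>{0<..<1}. ereal (\<bar>radial_profile u r\<bar> / sqrt (1 / (2 * pi) * ln (1 / r))))"

definition unit_ball_2star :: "((real^2) \<Rightarrow> real) set" where
  "unit_ball_2star = {u \<in> H10_radial. norm_2star u < 1}"

definition exp_functional :: "((real^2) \<Rightarrow> real) \<Rightarrow> real" where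
  "exp_functional u = integral\<^sup>L (lebesgue_on unit_disk) (\<lambda>x. exp (4 * pi * (u x)\<^sup>2))"

end

theory Submission
  imports Defs
begin

text \<open>If \<open>\<parallel>u\<parallel>\<^bsub>2*\<^esub> < t < 1\<close> then \<open>exp (4 \<pi> u\<^sup>2) \<le> |x| powr (- 2 t\<^sup>2)\<close>, which is integrable on
  the disk because \<open>2 t\<^sup>2 < 2\<close>. If moreover \<open>\<parallel>v - u\<parallel>\<^bsub>2*\<^esub> < \<delta>\<close>, the mean value theorem bounds
  \<open>|exp (4 \<pi> v\<^sup>2) - exp (4 \<pi> u\<^sup>2)|\<close> by \<open>4 \<delta> ln (1/|x|) |x| powr (- 2 s\<^sup>2)\<close> for some \<open>s\<close> with
  \<open>t < s < 1\<close>, and the logarithm is absorbed into a slightly larger exponent that is still below 2.\<close>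

section \<open>Integrability of negative powers of the norm on the unit ball\<close>

text \<open>Take \<open>k\<close> with \<open>(1/2) ^ Suc k \<le> r < (1/2) ^ k\<close>; a negative
  power is decreasing, so its value at the left endpoint is an upper bound.\<close>

lemma powr_dyadic_cover:
  fixes r p :: real
  assumes "0 < r" "r < 1" "0 \<le> p"
  shows "\<exists>k::nat. r < (1/2) ^ k \<and> r powr - p \<le> (2 powr p) ^ Suc k"
proof -
  obtain n where n: "(1/2) ^ n < r"
    using real_arch_pow_inv[of r "1/2"] assms by auto
  define m where "m = (LEAST n. (1/2) ^ n \<le> r)"
  have m: "(1/2) ^ m \<le> r"
    unfolding m_def by (rule LeastI[of _ n]) (use n in auto)
  have "m \<noteq> 0"
    using m assms by (cases m) auto
  then obtain k where k: "m = Suc k"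
    using not0_implies_Suc by blast
  have "r < (1/2) ^ k"
    using not_less_Least[of k "\<lambda>n. (1/2) ^ n \<le> r"] k unfolding m_def by auto
  moreover have "r powr - p \<le> ((1/2) ^ Suc k) powr - p"
    using m k assms by (intro powr_mono2') auto
  moreover have "((1/2) ^ Suc k) powr - p = (2 powr p) ^ Suc k"
  proof -
    have "((1/2) ^ Suc k :: real) = 2 powr - real (Suc k)"
      by (simp add: powr_minus powr_realpow power_one_over inverse_eq_divide del: of_nat_Suc power_Suc)
    then show ?thesis
      by (simp add: powr_powr powr_realpow[symmetric] mult.commute del: power_Suc of_nat_Suc)
  qed
  ultimately show ?thesis by metis
qed

text \<open>Dyadic balls replace polar coordinates: the ball of radius \<open>(1/2) ^ k\<close> has
  volume proportional to \<open>2 powr - (k * d)\<close> with \<open>d\<close> the dimension, so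
  weighting it by \<open>(2 powr p) ^ Suc k\<close> gives a geometric series of ratio
  \<open>2 powr p / 2 ^ d < 1\<close>.\<close>

lemma integrable_norm_powr_unit_ball:
  fixes p :: real
  assumes "0 \<le> p" "p < real DIM('a::euclidean_space)"
  shows "integrable (lebesgue_on (ball (0::'a) 1)) (\<lambda>x. norm x powr - p)"
proof -
  let ?d = "DIM('a)"
  define q where "q = 2 powr p / 2 ^ ?d"
  define c where "c k = (2 powr p) ^ Suc k" for k :: nat
  have "2 powr p < 2 powr real ?d"
    using assms by (intro powr_less_mono) auto
  then have q: "0 \<le> q" "q < 1"
    by (auto simp: q_def powr_realpow)
  have c: "0 \<le> c k" for k
    by (simp add: c_def)
  have vol: "emeasure lborel (ball (0::'a) ((1/2) ^ k)) = ennreal (unit_ball_vol ?d * ((1/2) ^ k) ^ ?d)" for k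
    by (simp add: emeasure_ball)
  have summand: "ennreal (c k) * emeasure lborel (ball (0::'a) ((1/2) ^ k))
      = ennreal (unit_ball_vol ?d * 2 powr p * q ^ k)" for k
  proof -
    have "c k * (unit_ball_vol ?d * ((1/2) ^ k) ^ ?d) = unit_ball_vol ?d * 2 powr p * q ^ k"
      by (simp add: c_def q_def power_divide power_mult[symmetric] mult.commute[of k])
    then show ?thesis
      unfolding vol using c by (metis ennreal_mult')
  qed
  have cover: "ennreal (norm x powr - p) * indicator (ball 0 1) x
      \<le> (\<Sum>k. ennreal (c k) * indicator (ball 0 ((1/2) ^ k)) x)" for x :: 'a
  proof (cases "x \<in> ball 0 1 - {0}")
    case True
    then obtain k where k: "norm x < (1/2) ^ k" "norm x powr - p \<le> c k"
      using powr_dyadic_cover[of "norm x" p] assms(1) unfolding c_def by force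
    have "ennreal (norm x powr - p) * indicator (ball 0 1) x
        \<le> ennreal (c k) * indicator (ball 0 ((1/2) ^ k)) x"
      using True k by (simp add: ennreal_leI)
    also have "\<dots> \<le> (\<Sum>k. ennreal (c k) * indicator (ball 0 ((1/2) ^ k)) x)"
    proof -
      have "f k \<le> suminf f" for f :: "nat \<Rightarrow> ennreal"
        using sum_le_suminf[of f "{k}"] by simp
      then show ?thesis .
    qed
    finally show ?thesis .
  next
    case False
    \<comment> \<open>At the origin the left side vanishes because \<open>0 powr - p = 0\<close> by
      convention; outside the ball the indicator kills it.\<close>
    then have zero: "ennreal (norm x powr - p) * indicator (ball 0 1) x = 0"
      by (cases "x = 0") (simp_all add: indicator_def)
    show ?thesis
      unfolding zero by (rule zero_le)
  qed
  have "(\<integral>\<^sup>+x. ennreal (norm x powr - p) * indicator (ball 0 1) x \<partial>(lborel :: 'a measure))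
      \<le> (\<integral>\<^sup>+x. (\<Sum>k. ennreal (c k) * indicator (ball 0 ((1/2) ^ k)) x) \<partial>(lborel :: 'a measure))"
    by (intro nn_integral_mono cover)
  also have "\<dots> = (\<Sum>k. ennreal (unit_ball_vol ?d * 2 powr p * q ^ k))"
  proof (subst nn_integral_suminf)
    show "(\<lambda>x. ennreal (c k) * indicator (ball (0::'a) ((1/2) ^ k)) x) \<in> borel_measurable lborel" for k
      by (intro borel_measurable_times_ennreal borel_measurable_const borel_measurable_indicator) simp
  qed (simp only: nn_integral_cmult_indicator summand sets_lborel borel_open open_ball)
  also have "\<dots> < \<infinity>"
    using q by (subst suminf_ennreal2) (simp_all add: summable_mult)
  finally have fin: "(\<integral>\<^sup>+x. ennreal (norm x powr - p) * indicator (ball 0 1) x \<partial>(lborel :: 'a measure)) < \<infinity>" .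
  have "set_integrable lborel (ball (0::'a) 1) (\<lambda>x. norm x powr - p)"
    unfolding set_integrable_def
  proof (rule integrableI_nonneg)
    have "(\<integral>\<^sup>+x. ennreal (indicat_real (ball 0 1) x *\<^sub>R norm x powr - p) \<partial>(lborel :: 'a measure))
        = (\<integral>\<^sup>+x. ennreal (norm x powr - p) * indicator (ball 0 1) x \<partial>(lborel :: 'a measure))"
      by (intro nn_integral_cong) (auto simp: indicator_def)
    then show "(\<integral>\<^sup>+x. ennreal (indicat_real (ball 0 1) x *\<^sub>R norm x powr - p) \<partial>(lborel :: 'a measure)) < \<infinity>"
      using fin by simp
    show "(\<lambda>x. indicat_real (ball (0::'a) 1) x *\<^sub>R norm x powr - p) \<in> borel_measurable lborel"
      by (intro borel_measurable_scaleR borel_measurable_indicator) simp_all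
  qed simp
  then have "set_integrable lebesgue (ball (0::'a) 1) (\<lambda>x. norm x powr - p)"
    unfolding set_integrable_def by (subst integrable_completion) simp_all
  then show ?thesis
    by (simp add: set_integrable_def integrable_restrict_space)
qed

section \<open>A null point and a mean value estimate\<close>

text \<open>Radial representatives are arbitrary at the origin, so pointwise bounds are available
  only off that point, which is a null set.\<close>

lemma AE_lebesgue_on_punctured:
  fixes S :: "'a::euclidean_space set"
  assumes "\<And>x. x \<in> S - {a} \<Longrightarrow> P x" "S \<in> sets lebesgue"
  shows "AE x in lebesgue_on S. P x"
proof -
  have "AE x in lebesgue. x \<notin> {a}"
    by (rule AE_not_in) auto
  then show ?thesis
    using assms by (subst AE_restrict_space_iff) auto
qed

text \<open>The mean value estimate, with \<open>exp M\<close> bounding the derivative; it is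
  obtained from \<open>1 + h \<le> exp h\<close> at \<open>h = x - y\<close>.\<close>

lemma abs_exp_diff_le:
  fixes a b M :: real
  assumes "a \<le> M" "b \<le> M"
  shows "\<bar>exp a - exp b\<bar> \<le> \<bar>a - b\<bar> * exp M"
proof -
  have *: "exp y - exp x \<le> (y - x) * exp M" if "x \<le> y" "y \<le> M" for x y :: real
  proof -
    have "exp y - exp x = exp y * (1 - exp (x - y))"
      by (simp add: exp_diff field_simps)
    also have "\<dots> \<le> exp y * (y - x)"
    proof (rule mult_left_mono)
      show "1 - exp (x - y) \<le> y - x"
        using exp_ge_add_one_self[of "x - y"] by linarith
    qed simp
    also have "\<dots> \<le> exp M * (y - x)"
      using that by (intro mult_right_mono) auto
    finally show ?thesis by (simp add: mult.commute)
  qed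
  show ?thesis
    using *[of a b] *[of b a] assms by (cases "a \<le> b") (auto simp: abs_if)
qed

section \<open>From the norm to pointwise bounds\<close>

text \<open>Stated for an arbitrary function \<open>w\<close>, so that it applies directly to a
  difference of two radial functions.\<close>

lemma norm_2star_pointwise:
  assumes "norm_2star w < ereal t" "0 < r" "r < 1"
  shows "\<bar>radial_profile w r\<bar> \<le> t * sqrt (1 / (2 * pi) * ln (1 / r))"
proof -
  have "ereal (\<bar>radial_profile w r\<bar> / sqrt (1 / (2 * pi) * ln (1 / r))) \<le> norm_2star w"
    unfolding norm_2star_def using assms by (intro SUP_upper) auto
  also have "\<dots> < ereal t" by fact
  finally have "\<bar>radial_profile w r\<bar> / sqrt (1 / (2 * pi) * ln (1 / r)) \<le> t"
    by simp
  moreover have "0 < sqrt (1 / (2 * pi) * ln (1 / r))"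
    using assms by (simp add: ln_div divide_less_0_iff)
  ultimately show ?thesis
    by (simp only: pos_divide_le_eq)
qed

text \<open>The point \<open>axis 1 (norm x)\<close> has the same norm as \<open>x\<close>, hence
  lies in the punctured disk, and rotation invariance applies.\<close>

lemma H10_radial_eq_profile:
  assumes "u \<in> H10_radial" "x \<in> unit_disk - {0}"
  shows "u x = radial_profile u (norm x)"
proof -
  have norm_eq: "norm (axis 1 (norm x) :: real^2) = norm x"
    by (simp add: norm_eq_sqrt_inner inner_axis_axis)
  then have "axis 1 (norm x) \<in> unit_disk - {0}"
    using assms(2) by (metis Diff_iff dist_0_norm insert_iff mem_ball norm_eq_zero singletonD)
  then show ?thesis
    using assms norm_eq[symmetric] unfolding H10_radial_def radial_profile_def by blast
qed

lemma exp_square_measurable: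
  assumes "u \<in> H10_radial"
  shows "(\<lambda>x. exp (4 * pi * (u x)\<^sup>2)) \<in> borel_measurable (lebesgue_on unit_disk)"
proof -
  have "u \<in> borel_measurable (lebesgue_on unit_disk)"
    using assms by (simp add: H10_radial_def H10_def L2_def)
  then show ?thesis by measurable
qed

lemma abs_le_of_norm_2star_less:
  assumes "u \<in> H10_radial" "norm_2star u < ereal t" "x \<in> unit_disk - {0}"
  shows "\<bar>u x\<bar> \<le> t * sqrt (1 / (2 * pi) * ln (1 / norm x))"
  using norm_2star_pointwise[OF assms(2), of "norm x"] H10_radial_eq_profile[OF assms(1,3)] assms(3)
  by auto

section \<open>Estimates for the exponential of the square\<close>

text \<open>After squaring, \<open>4 * pi\<close> meets the weight \<open>1 / (2 * pi)\<close> and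
  leaves the factor 2. In the uses, \<open>l\<close> is \<open>ln (1 / norm x)\<close>.\<close>

lemma exponent_le:
  fixes y l :: real
  assumes "\<bar>y\<bar> \<le> t * sqrt (1 / (2 * pi) * l)" "0 \<le> l"
  shows "4 * pi * y\<^sup>2 \<le> 2 * t\<^sup>2 * l"
proof -
  have "\<bar>y\<bar>\<^sup>2 \<le> (t * sqrt (1 / (2 * pi) * l))\<^sup>2"
    using assms(1) by (intro power_mono) auto
  also have "\<dots> = t\<^sup>2 * (1 / (2 * pi) * l)"
    using assms(2) by (simp add: power_mult_distrib)
  finally show ?thesis
    by (simp add: field_simps)
qed

lemma exp_ln_inverse_eq_powr:
  fixes r a :: real
  assumes "0 < r"
  shows "exp (a * ln (1 / r)) = r powr - a"
  using assms by (simp add: powr_def ln_div)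

text \<open>Ensures that \<open>exp_functional\<close> is a genuine integral and not the default
  value 0, and that two such integrals may be subtracted.\<close>

lemma exp_square_integrable:
  assumes "u \<in> H10_radial" "norm_2star u < ereal t" "0 \<le> t" "t < 1"
  shows "integrable (lebesgue_on unit_disk) (\<lambda>x. exp (4 * pi * (u x)\<^sup>2))"
proof (rule Bochner_Integration.integrable_bound)
  have "t\<^sup>2 < 1"
    using assms by (simp add: power_less_one_iff abs_square_less_1)
  then show "integrable (lebesgue_on unit_disk) (\<lambda>x. norm x powr - (2 * t\<^sup>2))"
    by (intro integrable_norm_powr_unit_ball) auto
  show "AE x in lebesgue_on unit_disk.
      norm (exp (4 * pi * (u x)\<^sup>2)) \<le> norm (norm x powr - (2 * t\<^sup>2))"
  proof (rule AE_lebesgue_on_punctured[where a = 0])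
    fix x :: "real^2" assume x: "x \<in> unit_disk - {0}"
    then have l: "0 \<le> ln (1 / norm x)"
      by (simp add: ln_div)
    have "exp (4 * pi * (u x)\<^sup>2) \<le> exp (2 * t\<^sup>2 * ln (1 / norm x))"
      using exponent_le[OF abs_le_of_norm_2star_less[OF assms(1,2) x] l] by simp
    also have "\<dots> = norm x powr - (2 * t\<^sup>2)"
      using x by (intro exp_ln_inverse_eq_powr) auto
    finally show "norm (exp (4 * pi * (u x)\<^sup>2)) \<le> norm (norm x powr - (2 * t\<^sup>2))"
      by simp
  qed auto
qed (rule exp_square_measurable[OF assms(1)])

text \<open>Factoring \<open>z\<^sup>2 - y\<^sup>2\<close> as \<open>(z - y) * (z + y)\<close>
  extracts one factor \<open>\<delta>\<close>; the remaining factor \<open>l\<close> is absorbed by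
  an exponential.\<close>

lemma exp_square_diff_le:
  fixes y z l :: real
  assumes "\<bar>y\<bar> \<le> s * sqrt (1 / (2 * pi) * l)" "\<bar>z\<bar> \<le> s * sqrt (1 / (2 * pi) * l)"
    and "\<bar>z - y\<bar> \<le> \<delta> * sqrt (1 / (2 * pi) * l)"
    and "0 < s" "s < 1" "0 < \<delta>" "0 \<le> l"
  shows "\<bar>exp (4 * pi * z\<^sup>2) - exp (4 * pi * y\<^sup>2)\<bar> \<le> 4 * \<delta> / (1 - s\<^sup>2) * exp ((1 + s\<^sup>2) * l)"
proof -
  define R where "R = sqrt (1 / (2 * pi) * l)"
  have R: "0 \<le> R" "R * R = l / (2 * pi)"
    using assms by (auto simp: R_def)
  have a: "0 < 1 - s\<^sup>2"
    using assms by (simp add: abs_square_less_1)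
  have "\<bar>z + y\<bar> \<le> 2 * s * R"
    using assms(1,2) unfolding R_def[symmetric] by linarith
  also have "\<dots> \<le> 2 * R"
    using assms R by (intro mult_right_mono) auto
  finally have "\<bar>z - y\<bar> * \<bar>z + y\<bar> \<le> (\<delta> * R) * (2 * R)"
    using assms(3,6) R unfolding R_def[symmetric] by (intro mult_mono) auto
  also have "\<dots> = \<delta> * (2 * (R * R))"
    by simp
  also have "\<dots> = \<delta> * l / pi"
    by (simp add: R)
  finally have *: "\<bar>z - y\<bar> * \<bar>z + y\<bar> \<le> \<delta> * l / pi" .
  have "4 * pi * z\<^sup>2 - 4 * pi * y\<^sup>2 = 4 * pi * ((z - y) * (z + y))"
    by (simp add: power2_eq_square algebra_simps)
  then have "\<bar>4 * pi * z\<^sup>2 - 4 * pi * y\<^sup>2\<bar> = 4 * pi * (\<bar>z - y\<bar> * \<bar>z + y\<bar>)"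
    by (simp add: abs_mult)
  also have "\<dots> \<le> 4 * pi * (\<delta> * l / pi)"
    using * by (intro mult_left_mono) auto
  also have "\<dots> = 4 * \<delta> * l"
    by simp
  \<comment> \<open>Absorbing \<open>l\<close> costs \<open>1 - s\<^sup>2\<close>, half of the gap
    between \<open>2 * s\<^sup>2\<close> and 2, so the final exponent \<open>1 + s\<^sup>2\<close>
    stays below 2.\<close>
  also have "\<dots> \<le> 4 * \<delta> * (exp ((1 - s\<^sup>2) * l) / (1 - s\<^sup>2))"
  proof (rule mult_left_mono)
    have "(1 - s\<^sup>2) * l \<le> exp ((1 - s\<^sup>2) * l)"
      using exp_ge_add_one_self[of "(1 - s\<^sup>2) * l"] by linarith
    then show "l \<le> exp ((1 - s\<^sup>2) * l) / (1 - s\<^sup>2)"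
      using a by (simp add: pos_le_divide_eq mult.commute)
  qed (use assms in simp)
  \<comment> \<open>The factor \<open>exp (2 * s\<^sup>2 * l)\<close> is the \<open>exp M\<close> of
    \<open>abs_exp_diff_le\<close>, since \<open>exponent_le\<close> puts both exponents below
    \<open>2 * s\<^sup>2 * l\<close>.\<close>
  finally have "\<bar>4 * pi * z\<^sup>2 - 4 * pi * y\<^sup>2\<bar> * exp (2 * s\<^sup>2 * l)
      \<le> 4 * \<delta> * (exp ((1 - s\<^sup>2) * l) / (1 - s\<^sup>2)) * exp (2 * s\<^sup>2 * l)"
    by (intro mult_right_mono) auto
  also have "\<dots> = 4 * \<delta> / (1 - s\<^sup>2) * exp ((1 - s\<^sup>2) * l + 2 * s\<^sup>2 * l)"
    by (simp add: exp_add)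
  also have "(1 - s\<^sup>2) * l + 2 * s\<^sup>2 * l = (1 + s\<^sup>2) * l"
    by (simp add: algebra_simps)
  finally show ?thesis
    using abs_exp_diff_le[OF exponent_le[OF assms(2,7)] exponent_le[OF assms(1,7)]] by linarith
qed

section \<open>Continuity of the functional\<close>

lemma norm_2star_less_real:
  assumes "norm_2star u < 1"
  obtains t :: real where "0 < t" "t < 1" "norm_2star u < ereal t"
proof -
  \<comment> \<open>The maximum with 0 makes the intermediate value positive; being also below 1, it
    is a finite real.\<close>
  have "max 0 (norm_2star u) < 1"
    using assms by simp
  then obtain t' where "max 0 (norm_2star u) < t'" "t' < 1"
    using dense by blast
  then show thesis
    by (cases t') (auto intro: that)
qed

theorem proposition1:
  "(\<forall>u\<in>unit_ball_2star.
      integrable (lebesgue_on unit_disk) (\<lambda>x. exp (4 * pi * (u x)\<^sup>2))) \<and>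
   (\<forall>u\<in>unit_ball_2star. \<forall>\<epsilon>>0. \<exists>\<delta>>0. \<forall>v\<in>unit_ball_2star.
      norm_2star (\<lambda>x. v x - u x) < ereal \<delta> \<longrightarrow>
      \<bar>exp_functional v - exp_functional u\<bar> < \<epsilon>)"
proof (intro conjI ballI allI impI)
  have integrable: "integrable (lebesgue_on unit_disk) (\<lambda>x. exp (4 * pi * (u x)\<^sup>2))"
    if "u \<in> unit_ball_2star" for u
  proof -
    obtain t where "0 < t" "t < 1" "norm_2star u < ereal t"
      using \<open>u \<in> unit_ball_2star\<close> norm_2star_less_real unfolding unit_ball_2star_def by blast
    then show ?thesis
      using that exp_square_integrable unfolding unit_ball_2star_def by simp
  qed
  then show "integrable (lebesgue_on unit_disk) (\<lambda>x. exp (4 * pi * (u x)\<^sup>2))"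
    if "u \<in> unit_ball_2star" for u
    using that .
  fix u and \<epsilon> :: real assume u: "u \<in> unit_ball_2star" and "0 < \<epsilon>"
  obtain t where t: "0 < t" "t < 1" "norm_2star u < ereal t"
    using u norm_2star_less_real unfolding unit_ball_2star_def by blast
  \<comment> \<open>The midpoint leaves room on both sides: above \<open>t\<close> for perturbing
    \<open>u\<close>, below 1 for integrability.\<close>
  define s where "s = (1 + t) / 2"
  have s: "0 < s" "s < 1" "t < s"
    using t by (auto simp: s_def)
  have a: "0 < 1 - s\<^sup>2"
    using s by (simp add: abs_square_less_1)
  define C where "C = integral\<^sup>L (lebesgue_on unit_disk) (\<lambda>x. norm x powr - (1 + s\<^sup>2))"
  have int: "integrable (lebesgue_on unit_disk) (\<lambda>x. norm x powr - (1 + s\<^sup>2))"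
    using a by (intro integrable_norm_powr_unit_ball) auto
  have C: "0 \<le> C"
    unfolding C_def by (intro integral_nonneg_AE) auto
  \<comment> \<open>The first entry keeps \<open>v\<close> below the level \<open>s\<close>; the
    second makes the final integral bound at most \<open>\<epsilon>\<close>. Using
    \<open>C + 1\<close> avoids division by zero and later yields the strict inequality.\<close>
  define \<delta> where "\<delta> = min (s - t) (\<epsilon> * (1 - s\<^sup>2) / (4 * (C + 1)))"
  have \<delta>: "0 < \<delta>" "\<delta> \<le> s - t" "\<delta> \<le> \<epsilon> * (1 - s\<^sup>2) / (4 * (C + 1))"
    using s a C \<open>0 < \<epsilon>\<close> by (auto simp: \<delta>_def)
  show "\<exists>\<delta>>0. \<forall>v\<in>unit_ball_2star. norm_2star (\<lambda>x. v x - u x) < ereal \<delta> \<longrightarrow>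
      \<bar>exp_functional v - exp_functional u\<bar> < \<epsilon>"
  proof (intro exI[of _ \<delta>] conjI ballI impI \<delta>)
    fix v assume v: "v \<in> unit_ball_2star" and d: "norm_2star (\<lambda>x. v x - u x) < ereal \<delta>"
    have rad: "u \<in> H10_radial" "v \<in> H10_radial"
      using u v by (auto simp: unit_ball_2star_def)
    have bound: "\<bar>exp (4 * pi * (v x)\<^sup>2) - exp (4 * pi * (u x)\<^sup>2)\<bar>
        \<le> 4 * \<delta> / (1 - s\<^sup>2) * norm x powr - (1 + s\<^sup>2)" if x: "x \<in> unit_disk - {0}" for x
    proof -
      define R where "R = sqrt (1 / (2 * pi) * ln (1 / norm x))"
      have l: "0 \<le> ln (1 / norm x)"
        using x by (simp add: ln_div)
      then have "0 \<le> R" by (simp add: R_def)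
      have u_le: "\<bar>u x\<bar> \<le> t * R"
        unfolding R_def by (rule abs_le_of_norm_2star_less[OF rad(1) t(3) x])
      have diff_le: "\<bar>v x - u x\<bar> \<le> \<delta> * R"
        using norm_2star_pointwise[OF d, of "norm x"] x
          H10_radial_eq_profile[OF rad(1) x] H10_radial_eq_profile[OF rad(2) x]
        unfolding R_def radial_profile_def by simp
      \<comment> \<open>The bound on \<open>v\<close> comes from \<open>u\<close> and
        \<open>\<delta>\<close> by the triangle inequality, so \<open>s\<close>, and with it the
        majorant, is the same for all \<open>v\<close>.\<close>
      have "(t + \<delta>) * R \<le> s * R" "t * R \<le> s * R"
        using \<open>0 \<le> R\<close> \<delta> s by (auto intro!: mult_right_mono)
      then have "\<bar>u x\<bar> \<le> s * R" "\<bar>v x\<bar> \<le> s * R"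
        using u_le diff_le by (auto simp: distrib_right)
      then have "\<bar>exp (4 * pi * (v x)\<^sup>2) - exp (4 * pi * (u x)\<^sup>2)\<bar>
          \<le> 4 * \<delta> / (1 - s\<^sup>2) * exp ((1 + s\<^sup>2) * ln (1 / norm x))"
        using diff_le s \<delta> l unfolding R_def by (intro exp_square_diff_le) auto
      also have "exp ((1 + s\<^sup>2) * ln (1 / norm x)) = norm x powr - (1 + s\<^sup>2)"
        using x by (intro exp_ln_inverse_eq_powr) auto
      finally show ?thesis .
    qed
    have "\<bar>exp_functional v - exp_functional u\<bar> = \<bar>integral\<^sup>L (lebesgue_on unit_disk)
        (\<lambda>x. exp (4 * pi * (v x)\<^sup>2) - exp (4 * pi * (u x)\<^sup>2))\<bar>"
      using integrable[OF u] integrable[OF v] by (simp add: exp_functional_def)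
    also have "\<dots> \<le> integral\<^sup>L (lebesgue_on unit_disk)
        (\<lambda>x. \<bar>exp (4 * pi * (v x)\<^sup>2) - exp (4 * pi * (u x)\<^sup>2)\<bar>)"
      by (rule integral_abs_bound)
    also have "\<dots> \<le> integral\<^sup>L (lebesgue_on unit_disk)
        (\<lambda>x. 4 * \<delta> / (1 - s\<^sup>2) * norm x powr - (1 + s\<^sup>2))"
      using integrable[OF u] integrable[OF v] int bound
      by (intro integral_mono_AE AE_lebesgue_on_punctured[where a = 0]) auto
    also have "\<dots> = 4 * \<delta> / (1 - s\<^sup>2) * C"
      by (simp add: C_def)
    also have "\<dots> < 4 * \<delta> / (1 - s\<^sup>2) * (C + 1)"
      using a \<delta> by (intro mult_strict_left_mono) auto
    also have "\<dots> \<le> \<epsilon>"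
      using a C \<delta>(3) by (simp add: field_simps)
    finally show "\<bar>exp_functional v - exp_functional u\<bar> < \<epsilon>" .
  qed
qed

end
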